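(* Let $n\ge 2$ and let $\mathbb{F}$ be a field with at least $n$ pairwise different elements. Then the $\mathrm{GL}_n$-orbits on $D_n$ are separated by the set $$\mathrm{Set}_{\mathrm{rank}}=\{\mathrm{rank}(F)\;|\;F\in \mathrm{alg}_{\mathbb{F}}\{X\}_2 \text{ with } \deg(F)\le (n+1)(2n-1)\}.$$ That is, if $\underline{A},\underline{B}\in D_n$ satisfy $\mathrm{rank}\,F(\underline{A})=\mathrm{rank}\,F(\underline{B})$ for all $F\in \mathrm{alg}_{\mathbb{F}}\{X\}_2$ with $\deg(F)\le (n+1)(2n-1)$, then $\mathrm{GL}_n\cdot\underline{A}=\mathrm{GL}_n\cdot\underline{B}$.
   Context: $\mathbb{F}$ is a field (possibly finite, of arbitrary characteristic). $M_n$ is the space of $n\times n$ matrices over $\mathbb{F}$, and $\mathrm{GL}_n=\mathrm{GL}_n(\mathbb{F})$ acts on $M_n^2$ by simultaneous conjugation: $g\cdot(A_1,A_2)=(gA_1g^{-1},gA_2g^{-1})$. $D_n\subset M_n^2$ is the set of all pairs $\underline{A}=(A_1,A_2)$ such that $A_1$ has $n$ distinct eigenvalues in $\mathbb{F}$; it is $\mathrm{GL}_n$-invariant. For $k=1,2$, $X_k=(x_{ij}(k))_{1\le i,j\le n}$ is the generic $n\times n$ matrix whose entries are independent commuting variables, and $\mathrm{alg}_{\mathbb{F}}\{X\}_2$ is the associative $\mathbb{F}$-algebra generated by $X_1,X_2$ and the identity matrix $I_n$. For $F\in \mathrm{alg}_{\mathbb{F}}\{X\}_2$ and $\underline{A}\in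 M_n^2$, $F(\underline{A})\in M_n$ is the result of substituting $x_{ij}(k)\mapsto (A_k)_{ij}$, i.e. $X_k\mapsto A_k$. The degree $\deg(F)$ is the minimal degree of a non-commutative polynomial $f$ (possibly with free term) in letters $x_1,x_2$ over $\mathbb{F}$ such that $F=f(X_1,X_2)$. *)

theory Defs
  imports
    "HOL-Library.Poly_Mapping"
    "Jordan_Normal_Form.Char_Poly"
    "Jordan_Normal_Form.DL_Rank"
begin

datatype letter = L1 | L2

fun pick :: "letter \<Rightarrow> 'b \<times> 'b \<Rightarrow> 'b" where
  "pick L1 (M1, M2) = M1"
| "pick L2 (M1, M2) = M2"

definition GL :: "nat \<Rightarrow> 'a::field mat set" where
  "GL n = {g \<in> carrier_mat n n. invertible_mat g}"

definition GL_orbit :: "nat \<Rightarrow> 'a::field mat \<times> 'a mat \<Rightarrow> ('a mat \<times> 'a mat) set" where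
  "GL_orbit n A = {(g * fst A * h, g * snd A * h) | g h.
     g \<in> GL n \<and> h \<in> carrier_mat n n \<and> inverts_mat g h \<and> inverts_mat h g}"

definition D :: "nat \<Rightarrow> ('a::field mat \<times> 'a mat) set" where
  "D n = {A. fst A \<in> carrier_mat n n \<and> snd A \<in> carrier_mat n n \<and>
     card {c. eigenvalue (fst A) c} = n}"

text \<open>Commutative polynomials in the variables \<open>x\<^sub>i\<^sub>j(k)\<close>, encoded as
  \<open>(i, j, k)\<close> with 0-based \<open>i\<close>, \<open>j\<close>: finitely supported maps from monomials
  (finitely supported exponent functions) to coefficients, with the convolution product.\<close>

type_synonym 'a cpoly = "((nat \<times> nat \<times> letter) \<Rightarrow>\<^sub>0 nat) \<Rightarrow>\<^sub>0 'a"

definition cvar :: "nat \<times> nat \<times> letter \<Rightarrow> 'a::field cpoly" where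
  "cvar v = Poly_Mapping.single (Poly_Mapping.single v 1) 1"

definition cconst :: "'a::field \<Rightarrow> 'a cpoly" where
  "cconst c = Poly_Mapping.single 0 c"

definition ceval :: "(nat \<times> nat \<times> letter \<Rightarrow> 'a::field) \<Rightarrow> 'a cpoly \<Rightarrow> 'a" where
  "ceval \<alpha> p = (\<Sum>m\<in>Poly_Mapping.keys p. Poly_Mapping.lookup p m *
     (\<Prod>v\<in>Poly_Mapping.keys m. \<alpha> v ^ Poly_Mapping.lookup m v))"

definition generic_mat :: "nat \<Rightarrow> letter \<Rightarrow> 'a::field cpoly mat" where
  "generic_mat n k = mat n n (\<lambda>(i, j). cvar (i, j, k))"

inductive_set generic_alg :: "nat \<Rightarrow> 'a::field cpoly mat set" for n where
  one: "1\<^sub>m n \<in> generic_alg n"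
| gen: "generic_mat n k \<in> generic_alg n"
| add: "F \<in> generic_alg n \<Longrightarrow> G \<in> generic_alg n \<Longrightarrow> F + G \<in> generic_alg n"
| mult: "F \<in> generic_alg n \<Longrightarrow> G \<in> generic_alg n \<Longrightarrow> F * G \<in> generic_alg n"
| smult: "F \<in> generic_alg n \<Longrightarrow> cconst c \<cdot>\<^sub>m F \<in> generic_alg n"

definition subst :: "'a::field cpoly mat \<Rightarrow> 'a mat \<times> 'a mat \<Rightarrow> 'a mat" where
  "subst F A = map_mat (ceval (\<lambda>(i, j, k). pick k A $$ (i, j))) F"

text \<open>Non-commutative polynomials: finitely supported coefficient functions on words.
  Only their degree and their values at the generic matrices are needed, so they carry no
  product here. The zero polynomial gets degree 0.\<close>

type_synonym 'a ncpoly = "letter list \<Rightarrow>\<^sub>0 'a"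

definition nc_degree :: "'a::field ncpoly \<Rightarrow> nat" where
  "nc_degree f = Max (insert 0 (length ` Poly_Mapping.keys f))"

primrec generic_word :: "nat \<Rightarrow> letter list \<Rightarrow> 'a::field cpoly mat" where
  "generic_word n [] = 1\<^sub>m n"
| "generic_word n (k # w) = generic_mat n k * generic_word n w"

definition nc_generic :: "nat \<Rightarrow> 'a::field ncpoly \<Rightarrow> 'a cpoly mat" where
  "nc_generic n f = mat n n (\<lambda>(i, j). \<Sum>w\<in>Poly_Mapping.keys f.
     cconst (Poly_Mapping.lookup f w) * generic_word n w $$ (i, j))"

text \<open>Meaningful for \<open>F \<in> generic_alg n\<close>, where such an \<open>f\<close> always exists.\<close>

definition generic_degree :: "nat \<Rightarrow> 'a::field cpoly mat \<Rightarrow> nat" where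
  "generic_degree n F = (LEAST d. \<exists>f. nc_degree f = d \<and> F = nc_generic n f)"

end

(*
  Ranks of A1 - c I determine the eigenvalues, so both pairs may be conjugated to (L, A') and
  (L, B') with the same diagonal matrix L having distinct entries. By Lagrange interpolation the
  elements sum a(k,l) x1^k x2 x1^l + sum b(k) x1^k with k, l < n, of degree at most 2n - 1, evaluate
  at (L, M) to an arbitrary Hadamard multiple of M plus an arbitrary diagonal matrix. It remains to
  see that if all Hadamard multiples of two matrices have equal ranks, then one matrix arises from
  the other by scaling rows and columns. View the common support as a bipartite graph on rows and
  columns: scalings can be adjusted along a spanning forest, and every further edge closes a cycle
  whose two alternating products are compared by the vanishing of a minor, that is, by a rank.
*)
theory Submission
  imports Defs
begin

section \<open>Ranks of products\<close>

context vec_space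
begin

lemma card_le_rank:
  assumes M: "M \<in> carrier_mat n m" and U: "U \<subseteq> span (set (cols M))" "lin_indpt U" "finite U"
  shows "card U \<le> rank M"
proof -
  have cM: "set (cols M) \<subseteq> carrier_vec n" using M cols_dim by blast
  have sub: "submodule class_ring (span (set (cols M))) V"
    using span_is_submodule cM by auto
  have subsp: "subspace class_ring (span (set (cols M))) V"
    using span_is_subspace cM by auto
  interpret S: vectorspace class_ring "span_vs (set (cols M))"
    using subspace_is_vs[OF subsp] .
  have "S.fin_dim" using fin_dim_span_cols[OF M] .
  moreover have "U \<subseteq> carrier (span_vs (set (cols M)))" using U by simp
  moreover have "S.lin_indpt U"
    using span_li_not_depend(2)[OF U(1) sub] U(2) by auto
  ultimately show ?thesis unfolding rank_def by (rule S.li_le_dim)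
qed

lemma rank_basis:
  assumes M: "M \<in> carrier_mat n m"
  obtains U where "U \<subseteq> set (cols M)" "finite U" "lin_indpt U" "card U = rank M"
proof -
  have "lin_indpt {}" by (simp add: finite_lin_indpt2)
  then obtain U where U: "finite U" "maximal U (\<lambda>T. T \<subseteq> set (cols M) \<and> lin_indpt T)"
    using maximal_exists_superset[of "set (cols M)" "\<lambda>T. T \<subseteq> set (cols M) \<and> lin_indpt T" "{}"]
    by auto
  then show ?thesis using rank_card_indpt[OF M U(2)] that[of U] unfolding maximal_def by auto
qed

lemma cols_mult_subset_span:
  assumes "M \<in> carrier_mat n m" "Q \<in> carrier_mat m k"
  shows "set (cols (M * Q)) \<subseteq> span (set (cols M))"
proof
  fix c assume "c \<in> set (cols (M * Q))"
  then obtain j where j: "j < k" "c = col (M * Q) j" using assms by (auto simp: cols_def)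
  then have "c = M *\<^sub>v col Q j" using col_mult2[OF assms] by simp
  moreover have "col Q j \<in> carrier_vec m" using assms j by auto
  ultimately show "c \<in> span (set (cols M))"
    using col_space_eq[OF assms(1)] assms unfolding col_space_def by auto
qed

lemma rank_mult_right_le:
  assumes M: "M \<in> carrier_mat n m" and Q: "Q \<in> carrier_mat m k"
  shows "rank (M * Q) \<le> rank M"
proof -
  obtain U where U: "U \<subseteq> set (cols (M * Q))" "finite U" "lin_indpt U" "card U = rank (M * Q)"
    using rank_basis[OF mult_carrier_mat[OF M Q]] .
  show ?thesis using card_le_rank[OF M _ U(3,2)] cols_mult_subset_span[OF M Q] U by auto
qed

lemma rank_mult_right_inv:
  assumes M: "M \<in> carrier_mat n m" and Q: "Q \<in> carrier_mat m m" "Q' \<in> carrier_mat m m"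
    and inv: "Q * Q' = 1\<^sub>m m"
  shows "rank (M * Q) = rank M"
proof -
  have "M = M * Q * Q'" using M Q inv by (simp add: assoc_mult_mat[of _ n m _ m _ m])
  then have "rank M \<le> rank (M * Q)" using rank_mult_right_le[of "M * Q" m Q' m] M Q by simp
  with rank_mult_right_le[OF M Q(1)] show ?thesis by simp
qed

lemma rank_mult_left_le:
  assumes M: "M \<in> carrier_mat n m" and P: "P \<in> carrier_mat n n" "P' \<in> carrier_mat n n"
    and inv: "P' * P = 1\<^sub>m n"
  shows "rank M \<le> rank (P * M)"
proof -
  obtain U where U: "U \<subseteq> set (cols M)" "finite U" "lin_indpt U" "card U = rank M"
    using rank_basis[OF M] .
  obtain us where us: "set us = U" "distinct us" using U(2) finite_distinct_list by blast
  have Uc: "U \<subseteq> carrier_vec n" using U(1) M cols_dim by blast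
  define W where "W = mat_of_cols n us"
  have W: "W \<in> carrier_mat n (length us)" unfolding W_def by simp
  have cW: "cols W = us" unfolding W_def using us Uc by (intro cols_mat_of_cols) auto
  have inj: "u = v" if "u \<in> carrier_vec n" "v \<in> carrier_vec n" "P *\<^sub>v u = P *\<^sub>v v" for u v
  proof -
    have "P' *\<^sub>v (P *\<^sub>v u) = P' *\<^sub>v (P *\<^sub>v v)" using that by simp
    then have "(P' * P) *\<^sub>v u = (P' * P) *\<^sub>v v"
      using assoc_mult_mat_vec[OF P(2,1)] that by simp
    then show ?thesis using that inv by simp
  qed
  have cPW: "cols (P * W) = map ((*\<^sub>v) P) us"
  proof (rule nth_equalityI)
    fix i assume "i < length (cols (P * W))"
    then have i: "i < length us" using P W by simp
    then have "col W i = us ! i" using cW W by (metis carrier_matD(2) cols_nth)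
    then show "cols (P * W) ! i = map ((*\<^sub>v) P) us ! i"
      using i P W col_mult2[OF P(1) W i] by simp
  qed (use P W in simp)
  have dPW: "distinct (cols (P * W))"
    unfolding cPW using us Uc inj by (auto simp: distinct_map inj_on_def subset_iff)
  have "lin_indpt (set (cols (P * W)))"
  proof
    assume "lin_dep (set (cols (P * W)))"
    then obtain v where v: "v \<in> carrier_vec (length us)" "v \<noteq> 0\<^sub>v (length us)" "(P * W) *\<^sub>v v = 0\<^sub>v n"
      using lin_depE[of "P * W" "length us"] dPW P W by (metis mult_carrier_mat)
    have "P *\<^sub>v 0\<^sub>v n = 0\<^sub>v n" using P by (intro eq_vecI) auto
    then have "P *\<^sub>v (W *\<^sub>v v) = P *\<^sub>v 0\<^sub>v n" using v P W
      by (simp add: assoc_mult_mat_vec[of _ n n _ "length us"])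
    then have "W *\<^sub>v v = 0\<^sub>v n" using inj W v by (metis mult_mat_vec_carrier zero_carrier_vec)
    then have "lin_dep (set (cols W))" using lin_depI[OF W v(1,2)] cW us by auto
    then show False using cW us U by simp
  qed
  moreover have "set (cols (P * W)) \<subseteq> set (cols (P * M))"
  proof -
    have "set (cols (P * W)) = (*\<^sub>v) P ` U" using cPW us by auto
    moreover have "P *\<^sub>v u \<in> set (cols (P * M))" if "u \<in> U" for u
    proof -
      from that U(1) obtain j where "j < m" "u = col M j" using M by (auto simp: cols_def)
      then show ?thesis using P M by (auto simp: cols_def col_mult2 image_iff intro!: bexI[of _ j])
    qed
    ultimately show ?thesis by auto
  qed
  ultimately have "card (set (cols (P * W))) \<le> rank (P * M)"
    using rank_ge_card_indpt[OF mult_carrier_mat[OF P(1) M]] by blast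
  moreover have "card (set (cols (P * W))) = rank M"
    using distinct_card[OF dPW] distinct_card[OF us(2)] us U by (simp add: cPW)
  ultimately show ?thesis by simp
qed

lemma rank_mult_left_inv:
  assumes M: "M \<in> carrier_mat n m" and P: "P \<in> carrier_mat n n" "P' \<in> carrier_mat n n"
    and inv: "P' * P = 1\<^sub>m n"
  shows "rank (P * M) = rank M"
proof -
  have inv': "P * P' = 1\<^sub>m n" using mat_mult_left_right_inverse[OF P(2,1) inv] .
  have "P' * (P * M) = M" using M P inv by (simp add: assoc_mult_mat[of _ n n _ n _ m, symmetric])
  then have "rank (P * M) \<le> rank M"
    using rank_mult_left_le[OF mult_carrier_mat[OF P(1) M] P(2,1) inv'] by simp
  with rank_mult_left_le[OF M P inv] show ?thesis by simp
qed

lemma rank_mult_right_less: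
  assumes N: "N \<in> carrier_mat n m" and K: "K \<in> carrier_mat m k" and x: "x \<in> carrier_vec n"
    and xM: "\<And>j. j < k \<Longrightarrow> x \<bullet> col (N * K) j = 0"
    and xN: "j < m" "x \<bullet> col N j \<noteq> 0"
  shows "rank (N * K) < rank N"
proof -
  have M: "N * K \<in> carrier_mat n k" using N K by simp
  obtain U where U: "U \<subseteq> set (cols (N * K))" "finite U" "lin_indpt U" "card U = rank (N * K)"
    using rank_basis[OF M] .
  have cM: "set (cols (N * K)) \<subseteq> carrier_vec n" using M cols_dim by blast
  then have Uc: "U \<subseteq> carrier_vec n" using U by auto
  let ?c = "col N j"
  have "?c \<notin> span (set (cols (N * K)))"
  proof
    assume "?c \<in> span (set (cols (N * K)))"
    then obtain v where v: "v \<in> carrier_vec k" "(N * K) *\<^sub>v v = ?c"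
      using col_space_eq[OF M] M unfolding col_space_def by auto
    have "x \<bullet> ((N * K) *\<^sub>v v) = ((N * K)\<^sup>T *\<^sub>v x) \<bullet> v"
      using transpose_vec_mult_scalar[OF M v(1) x] by simp
    also have "(N * K)\<^sup>T *\<^sub>v x = 0\<^sub>v k"
      using xM M x N K by (intro eq_vecI) (auto simp: comm_scalar_prod[of _ n x])
    finally show False using v xN by simp
  qed
  then have notin: "?c \<notin> span U" "?c \<notin> U" using span_is_monotone[OF U(1)] U(1) span_mem[OF _ , of "set (cols (N*K))"] cM by auto
  have cc: "?c \<in> carrier_vec n" using N by auto
  have "lin_indpt (insert ?c U)"
    using lin_dep_iff_in_span[of U ?c] Uc U(3) notin cc by auto
  moreover have "insert ?c U \<subseteq> span (set (cols N))"
  proof -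
    have "?c \<in> set (cols N)" using N xN by (auto simp: cols_def)
    then have "?c \<in> span (set (cols N))" using span_mem[of "set (cols N)"] N cols_dim by auto
    then show ?thesis using U(1) cols_mult_subset_span[OF N K] by auto
  qed
  ultimately have "card (insert ?c U) \<le> rank N" using card_le_rank[OF N] U(2) by auto
  then show ?thesis using U notin by simp
qed

end

section \<open>Path matrices\<close>

text \<open>\<open>N\<close> is a matrix supported on \<open>T\<close> with \<open>N y = e\<^sub>p\<close> and \<open>x\<^sup>T N = e\<^sub>q\<^sup>T\<close>; in that case
  \<open>x\<^sub>p = y\<^sub>q\<close>, and adding \<open>c\<close> at position \<open>(p, q)\<close> changes the rank only for \<open>c = - 1 / y\<^sub>q\<close>. Such an
  \<open>N\<close> exists when row \<open>p\<close> and column \<open>q\<close> are connected in the bipartite graph \<open>T\<close>: it plays the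
  role of the matrix of a simple path, built here without mentioning paths.\<close>

definition path_matrix ::
    "nat \<Rightarrow> (nat \<times> nat) set \<Rightarrow> nat \<Rightarrow> nat \<Rightarrow> (nat \<Rightarrow> nat \<Rightarrow> 'a::field) \<Rightarrow> (nat \<Rightarrow> 'a) \<Rightarrow> (nat \<Rightarrow> 'a) \<Rightarrow> bool" where
  "path_matrix n T p q N x y \<longleftrightarrow> (\<forall>i j. N i j \<noteq> 0 \<longrightarrow> (i, j) \<in> T) \<and>
     (\<forall>i<n. (\<Sum>j<n. N i j * y j) = of_bool (i = p)) \<and>
     (\<forall>j<n. (\<Sum>i<n. x i * N i j) = of_bool (j = q)) \<and> y q \<noteq> 0"

lemma path_matrixI:
  assumes "\<And>i j. N i j \<noteq> 0 \<Longrightarrow> (i, j) \<in> T" "\<And>i. i < n \<Longrightarrow> (\<Sum>j<n. N i j * y j) = of_bool (i = p)"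
    "\<And>j. j < n \<Longrightarrow> (\<Sum>i<n. x i * N i j) = of_bool (j = q)" "y q \<noteq> 0"
  shows "path_matrix n T p q N x y"
  using assms unfolding path_matrix_def by blast

lemma path_matrixD:
  assumes "path_matrix n T p q N x y"
  shows "N i j \<noteq> 0 \<Longrightarrow> (i, j) \<in> T" "i < n \<Longrightarrow> (\<Sum>j<n. N i j * y j) = of_bool (i = p)"
    "j < n \<Longrightarrow> (\<Sum>i<n. x i * N i j) = of_bool (j = q)" "y q \<noteq> 0"
  using assms unfolding path_matrix_def by blast+

lemma path_matrix_mono: "path_matrix n T p q N x y \<Longrightarrow> T \<subseteq> T' \<Longrightarrow> path_matrix n T' p q N x y"
  unfolding path_matrix_def by blast

text \<open>\<open>R\<close> and \<open>Q\<close> are the rows and the columns of the connected component of row \<open>p\<close>.\<close>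

lemma connected_component_path_matrix:
  fixes T :: "(nat \<times> nat) set"
  assumes T: "T \<subseteq> {..<n} \<times> {..<n}" and p: "p < n"
  obtains R Q where "p \<in> R" "\<And>i j. (i, j) \<in> T \<Longrightarrow> i \<in> R \<longleftrightarrow> j \<in> Q"
    "\<And>q. q \<in> Q \<Longrightarrow> \<exists>N x (y :: nat \<Rightarrow> 'a::field). path_matrix n T p q N x y"
proof -
  define conn where "conn R Q q \<longleftrightarrow> (\<exists>N x (y :: nat \<Rightarrow> 'a). path_matrix n (T \<inter> R \<times> Q) p q N x y)" for R Q q
  define good where "good R \<longleftrightarrow> p \<in> R \<and> R \<subseteq> {..<n} \<and> (\<forall>q \<in> T `` R. conn R (T `` R) q)" for R
  have "conn {p} (T `` {p}) q" if q: "(p, q) \<in> T" for q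
  proof -
    have "q < n" using q T by auto
    let ?N = "\<lambda>i j. if j = q then of_bool (i = p) else (0::'a)"
    have "(\<Sum>j<n. ?N i j * of_bool (j = q)) = of_bool (i = p)" for i
    proof -
      have "?N i j * of_bool (j = q) = (if j = q then of_bool (i = p) else 0)" for j by simp
      then show ?thesis using \<open>q < n\<close> by simp
    qed
    moreover have "(\<Sum>i<n. of_bool (i = p) * ?N i j) = of_bool (j = q)" for j
    proof -
      have "of_bool (i = p) * ?N i j = (if i = p then of_bool (j = q) else 0)" for i by simp
      then show ?thesis using p by simp
    qed
    ultimately have "path_matrix n (T \<inter> {p} \<times> T `` {p}) p q ?N (\<lambda>i. of_bool (i = p)) (\<lambda>j. of_bool (j = q))"
      using q by (intro path_matrixI) (auto split: if_splits)
    then show ?thesis unfolding conn_def by blast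
  qed
  then have good0: "good {p}" unfolding good_def using p by auto
  have "finite {R. good R}"
    by (rule finite_subset[of _ "Pow {..<n}"]) (auto simp: good_def)
  then obtain R where R: "good R" and max: "\<And>R'. good R' \<Longrightarrow> R \<subseteq> R' \<Longrightarrow> R' = R"
    using finite_has_maximal[of "{R. good R}"] good0 by auto
  let ?Q = "T `` R"
  have closed: "i \<in> R" if iT: "(i, q) \<in> T" and q: "q \<in> ?Q" for i q
  proof (rule ccontr)
    assume i: "i \<notin> R"
    have lt: "i < n" "q < n" using iT T by auto
    let ?R' = "insert i R" and ?Q' = "T `` insert i R"
    have "conn ?R' ?Q' q'" if q': "(i, q') \<in> T" "q' \<notin> ?Q" for q'
    proof -
      have ltq': "q' < n" using q' T by auto
      from R q have "conn R ?Q q" unfolding good_def by auto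
      then obtain N x y where pm: "path_matrix n (T \<inter> R \<times> ?Q) p q N x (y :: nat \<Rightarrow> 'a)"
        unfolding conn_def by blast
      note N = path_matrixD(1)[OF pm] and Ny = path_matrixD(2)[OF pm]
        and xN = path_matrixD(3)[OF pm] and yq = path_matrixD(4)[OF pm]
      have N0: "N i j = 0" for j using N i by blast
      have N1: "N k q' = 0" for k using N q' by blast
      have neq: "q \<noteq> q'" using q q' by auto
      define N' where "N' k j = N k j + of_bool (k = i) * (of_bool (j = q) - of_bool (j = q'))" for k j
      define y' where "y' = y(q' := y q)"
      define x' where "x' = (\<lambda>k. if k = i then -1 else x k)"
      have c1: "(k, j) \<in> T \<inter> ?R' \<times> ?Q'" if "N' k j \<noteq> 0" for k j
        using that N[of k j] iT q' unfolding N'_def by (cases "k = i"; cases "j = q"; cases "j = q'") auto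
      have c2: "(\<Sum>j<n. N' k j * y' j) = of_bool (k = p)" if "k < n" for k
      proof -
        have eq: "N' k j * y' j = N k j * y j + of_bool (k = i) *
            ((if j = q then y q else 0) - (if j = q' then y q else 0))" for j
          using N1[of k] neq unfolding N'_def y'_def by (auto simp: distrib_right)
        have "(\<Sum>j<n. N' k j * y' j) = (\<Sum>j<n. N k j * y j) +
            of_bool (k = i) * (\<Sum>j<n. (if j = q then y q else 0) - (if j = q' then y q else 0))"
          unfolding eq sum.distrib sum_distrib_left ..
        then show ?thesis using Ny[OF that] lt ltq' by (simp add: sum_subtractf)
      qed
      have c3: "(\<Sum>k<n. x' k * N' k j) = of_bool (j = q')" if "j < n" for j
      proof -
        have eq: "x' k * N' k j = x k * N k j + (if k = i then of_bool (j = q') - of_bool (j = q) else 0)" for k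
          using N0 unfolding N'_def x'_def by auto
        have "(\<Sum>k<n. x' k * N' k j) = (\<Sum>k<n. x k * N k j) +
            (\<Sum>k<n. if k = i then of_bool (j = q') - of_bool (j = q) else 0)"
          unfolding eq sum.distrib ..
        then show ?thesis using xN[OF that] lt by simp
      qed
      have c4: "y' q' \<noteq> 0" using yq by (simp add: y'_def)
      show ?thesis using path_matrixI[OF c1 c2 c3 c4] unfolding conn_def by blast
    qed
    moreover have "conn ?R' ?Q' q'" if q': "q' \<in> ?Q" for q'
    proof -
      have "T \<inter> R \<times> ?Q \<subseteq> T \<inter> ?R' \<times> ?Q'" by auto
      moreover have "conn R ?Q q'" using R q' unfolding good_def by blast
      ultimately show ?thesis unfolding conn_def using path_matrix_mono by blast
    qed
    ultimately have "\<forall>q'\<in>?Q'. conn ?R' ?Q' q'" by blast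
    then have "good ?R'" using R lt unfolding good_def by auto
    then show False using max[of ?R'] i by auto
  qed
  show thesis
  proof (rule that[of R ?Q])
    show "p \<in> R" using R unfolding good_def by simp
    show "\<exists>N x (y :: nat \<Rightarrow> 'a). path_matrix n T p q N x y" if "q \<in> ?Q" for q
    proof -
      have "conn R ?Q q" using R that unfolding good_def by auto
      then show ?thesis unfolding conn_def using path_matrix_mono[of n "T \<inter> R \<times> ?Q"] by blast
    qed
    show "i \<in> R \<longleftrightarrow> j \<in> ?Q" if "(i, j) \<in> T" for i j
      using that closed[OF that] by blast
  qed
qed

section \<open>Ranks of Hadamard multiples\<close>

definition diagm :: "nat \<Rightarrow> (nat \<Rightarrow> 'a::field) \<Rightarrow> 'a mat" where
  "diagm n u = mat n n (\<lambda>(i, j). if i = j then u i else 0)"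

lemma diagm_carrier [simp]: "diagm n u \<in> carrier_mat n n"
  by (simp add: diagm_def)

lemma diagm_mult_left:
  assumes "M \<in> carrier_mat n n"
  shows "diagm n u * M = mat n n (\<lambda>(i, j). u i * M $$ (i, j))"
  using assms unfolding diagm_def
  by (intro eq_matI) (auto simp: scalar_prod_def if_distrib if_distribR cong: if_cong)

lemma diagm_mult_right:
  assumes "M \<in> carrier_mat n n"
  shows "M * diagm n u = mat n n (\<lambda>(i, j). M $$ (i, j) * u j)"
  using assms unfolding diagm_def
  by (intro eq_matI) (auto simp: scalar_prod_def if_distrib if_distribR cong: if_cong)

lemma diagm_mult_diagm: "diagm n u * diagm n v = diagm n (\<lambda>i. u i * v i)"
  by (subst diagm_mult_left) (auto simp: diagm_def)

lemma diagm_one: "(\<And>i. i < n \<Longrightarrow> u i = 1) \<Longrightarrow> diagm n u = 1\<^sub>m n"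
  by (auto simp: diagm_def)

lemma diagm_pow: "diagm n u ^\<^sub>m k = diagm n (\<lambda>i. u i ^ k)"
proof (induction k)
  case 0
  have "dim_row (diagm n u) = n" by (simp add: diagm_def)
  then show ?case by (simp add: diagm_one)
qed (simp add: diagm_mult_diagm mult.commute)

lemma rank_diag_scale:
  fixes u v :: "nat \<Rightarrow> 'a::field"
  assumes "\<And>i. i < n \<Longrightarrow> u i \<noteq> 0" "\<And>i. i < n \<Longrightarrow> v i \<noteq> 0"
  shows "vec_space.rank n (mat n n (\<lambda>(i, j). u i * N i j * v j)) = vec_space.rank n (mat n n (\<lambda>(i, j). N i j))"
proof -
  interpret vec_space "TYPE('a)" n .
  define M where "M = mat n n (\<lambda>(i, j). N i j)"
  have M: "M \<in> carrier_mat n n" unfolding M_def by simp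
  have eq: "mat n n (\<lambda>(i, j). u i * N i j * v j) = diagm n u * M * diagm n v"
    unfolding diagm_mult_left[OF M] by (subst diagm_mult_right) (auto simp: M_def)
  have inv: "diagm n (\<lambda>i. inverse (u i)) * diagm n u = 1\<^sub>m n" "diagm n v * diagm n (\<lambda>i. inverse (v i)) = 1\<^sub>m n"
    using assms by (simp_all add: diagm_mult_diagm diagm_one)
  have "rank (diagm n u * M * diagm n v) = rank (diagm n u * M)"
    by (rule rank_mult_right_inv[OF mult_carrier_mat[OF diagm_carrier M] _ _ inv(2)]) simp_all
  also have "\<dots> = rank M"
    by (rule rank_mult_left_inv[OF M _ _ inv(1)]) simp_all
  finally show ?thesis unfolding eq M_def .
qed

lemma rank_rank_one_update_eq_iff:
  fixes N :: "nat \<Rightarrow> nat \<Rightarrow> 'a::field"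
  assumes p: "p < n" and q: "q < n"
    and pm: "path_matrix n T p q N x y"
  shows "vec_space.rank n (mat n n (\<lambda>(i, j). N i j + c * of_bool (i = p \<and> j = q))) =
    vec_space.rank n (mat n n (\<lambda>(i, j). N i j)) \<longleftrightarrow> c * y q \<noteq> -1"
proof -
  interpret vec_space "TYPE('a)" n .
  note Ny = path_matrixD(2)[OF pm] and xN = path_matrixD(3)[OF pm]
  let ?N = "mat n n (\<lambda>(i, j). N i j)"
  define M where "M c = mat n n (\<lambda>(i, j). N i j + c * of_bool (i = p \<and> j = q))" for c
  define K where "K c = mat n n (\<lambda>(i, j). of_bool (i = j) + c * y i * of_bool (j = q))" for c
  have [simp]: "?N \<in> carrier_mat n n" "K c \<in> carrier_mat n n" "M c \<in> carrier_mat n n" for c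
    unfolding K_def M_def by simp_all
  have M: "M c = ?N * K c" for c
  proof (intro eq_matI)
    fix i j assume "i < dim_row (?N * K c)" "j < dim_col (?N * K c)"
    then have ij: "i < n" "j < n" by (simp_all add: K_def)
    have "(?N * K c) $$ (i, j) = (\<Sum>k<n. N i k * of_bool (k = j) + c * of_bool (j = q) * (N i k * y k))"
      using ij by (simp add: scalar_prod_def K_def atLeast0LessThan algebra_simps)
    also have "\<dots> = (\<Sum>k<n. N i k * of_bool (k = j)) + c * of_bool (j = q) * of_bool (i = p)"
      using Ny[OF ij(1)] by (simp add: sum.distrib flip: sum_distrib_left)
    also have "(\<Sum>k<n. N i k * of_bool (k = j)) = (\<Sum>k<n. if k = j then N i k else 0)"
      by (intro sum.cong) auto
    finally show "M c $$ (i, j) = (?N * K c) $$ (i, j)"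
      using ij by (cases "i = p"; cases "j = q") (simp_all add: M_def)
  qed (simp_all add: M_def K_def)
  have KK: "K c * K d = 1\<^sub>m n" if "c + d + c * d * y q = 0" for c d
  proof (intro eq_matI)
    fix i j assume "i < dim_row (1\<^sub>m n :: 'a mat)" "j < dim_col (1\<^sub>m n :: 'a mat)"
    then have ij: "i < n" "j < n" by simp_all
    have "(K c * K d) $$ (i, j) = (\<Sum>k<n. (of_bool (i = k) + c * y i * of_bool (k = q)) * (of_bool (k = j) + d * y k * of_bool (j = q)))"
      using ij by (simp add: scalar_prod_def K_def atLeast0LessThan)
    also have "\<dots> = (\<Sum>k<n. (if k = i then of_bool (i = j) + d * y i * of_bool (j = q) else 0)
        + (if k = q then c * y i * of_bool (j = q) + c * y i * d * y q * of_bool (j = q) else 0))"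
      by (intro sum.cong) (auto simp: algebra_simps)
    also have "\<dots> = of_bool (i = j) + (c + d + c * d * y q) * y i * of_bool (j = q)"
      using ij q by (simp add: sum.distrib algebra_simps)
    finally show "(K c * K d) $$ (i, j) = 1\<^sub>m n $$ (i, j)" using ij that by simp
  qed (simp_all add: K_def)
  have xp: "x p = y q"
  proof -
    have "x p = (\<Sum>i<n. if i = p then x i else 0)" using p by simp
    also have "\<dots> = (\<Sum>i<n. x i * (\<Sum>j<n. N i j * y j))"
      by (intro sum.cong) (use Ny in auto)
    also have "\<dots> = (\<Sum>i<n. \<Sum>j<n. x i * N i j * y j)"
      by (simp add: sum_distrib_left mult.assoc)
    also have "\<dots> = (\<Sum>j<n. (\<Sum>i<n. x i * N i j) * y j)"
      by (subst sum.swap) (simp add: sum_distrib_right)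
    also have "\<dots> = (\<Sum>j<n. if j = q then y j else 0)"
      by (intro sum.cong) (use xN in auto)
    finally show ?thesis using q by simp
  qed
  show ?thesis
    \<comment> \<open>\<open>K c\<close> is invertible unless \<open>1 + c y\<^sub>q = 0\<close>, and then \<open>x\<^sup>T N K c = 0\<close> although \<open>x\<^sup>T N \<noteq> 0\<close>.\<close>
  proof (cases "c * y q = -1")
    case True
    have "rank (?N * K c) < rank ?N"
    proof (rule rank_mult_right_less[of _ n _ n "vec n x" q])
      show "vec n x \<bullet> col (?N * K c) j = 0" if "j < n" for j
      proof -
        have "vec n x \<bullet> col (M c) j = (\<Sum>i<n. x i * (N i j + c * of_bool (i = p \<and> j = q)))"
          using that by (simp add: M_def scalar_prod_def atLeast0LessThan)
        also have "\<dots> = (\<Sum>i<n. x i * N i j + (if i = p then x p * c * of_bool (j = q) else 0))"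
          by (intro sum.cong) (auto simp: distrib_left)
        also have "\<dots> = of_bool (j = q) * (1 + c * y q)"
          using xN[OF that] xp p by (simp add: sum.distrib algebra_simps)
        finally show ?thesis using True by (simp add: M)
      qed
      show "vec n x \<bullet> col ?N q \<noteq> 0"
        using xN[OF q] q by (simp add: scalar_prod_def atLeast0LessThan)
    qed (use q in simp_all)
    then show ?thesis using True M[of c] unfolding M_def by simp
  next
    case False
    then have ne: "1 + c * y q \<noteq> 0" by (simp add: add_eq_0_iff)
    define d where "d = - c / (1 + c * y q)"
    have "c + d + c * d * y q = 0"
      using ne unfolding d_def by (simp add: field_simps)
    then have "rank (?N * K c) = rank ?N"
      using rank_mult_right_inv[of ?N n "K c" "K d"] KK by simp
    then show ?thesis using False M[of c] unfolding M_def by simp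
  qed
qed

lemma rank_eq_0_iff:
  fixes M :: "'a::field mat"
  assumes M: "M \<in> carrier_mat n m"
  shows "vec_space.rank n M = 0 \<longleftrightarrow> M = 0\<^sub>m n m"
proof
  interpret vec_space "TYPE('a)" n .
  assume r: "rank M = 0"
  show "M = 0\<^sub>m n m"
  proof (rule ccontr)
    assume "M \<noteq> 0\<^sub>m n m"
    then obtain i j where ij: "i < n" "j < m" "M $$ (i, j) \<noteq> 0"
      using M by (metis eq_matI carrier_matD index_zero_mat)
    have "rank (M * 0\<^sub>m m m) < rank M"
      by (rule rank_mult_right_less[OF M, of _ m "unit_vec n i" j])
        (use M ij in \<open>auto simp: scalar_prod_left_unit[of _ n]\<close>)
    then show False using r by simp
  qed
next
  interpret vec_space "TYPE('a)" n .
  show "rank M = 0" if "M = 0\<^sub>m n m" using that rank_0I by simp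
qed

lemma rank_hadamard_eq_imp_scaled:
  fixes A B :: "nat \<Rightarrow> nat \<Rightarrow> 'a::field"
  assumes eq: "\<And>C. vec_space.rank n (mat n n (\<lambda>(i, j). C i j * A i j)) =
    vec_space.rank n (mat n n (\<lambda>(i, j). C i j * B i j))"
  obtains u v where "\<And>i. i < n \<Longrightarrow> u i \<noteq> 0" "\<And>i. i < n \<Longrightarrow> v i \<noteq> 0"
    "\<And>i j. i < n \<Longrightarrow> j < n \<Longrightarrow> B i j = u i * A i j * v j"
proof -
  let ?rank = "\<lambda>N. vec_space.rank n (mat n n (\<lambda>(i, j). N i j))"
  have supp: "A i j = 0 \<longleftrightarrow> B i j = 0" if "i < n" "j < n" for i j
  proof -
    have "?rank (\<lambda>k l. of_bool (k = i \<and> l = j) * E k l) = 0 \<longleftrightarrow> E i j = 0" for E :: "nat \<Rightarrow> nat \<Rightarrow> 'a"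
    proof -
      let ?M = "mat n n (\<lambda>(k, l). of_bool (k = i \<and> l = j) * E k l)"
      have "?M = 0\<^sub>m n n \<longleftrightarrow> E i j = 0"
      proof
        assume "?M = 0\<^sub>m n n"
        then have "?M $$ (i, j) = 0\<^sub>m n n $$ (i, j)" by simp
        then show "E i j = 0" using that by simp
      qed (auto intro!: eq_matI)
      then show ?thesis using rank_eq_0_iff[of ?M n n] by simp
    qed
    from this[of A] this[of B] show ?thesis using eq[of "\<lambda>k l. of_bool (k = i \<and> l = j)"] by simp
  qed
  define S where "S = {(i, j). i < n \<and> j < n \<and> A i j \<noteq> 0}"
  define scaled where "scaled u v T \<longleftrightarrow> (\<forall>i<n. u i \<noteq> 0 \<and> v i \<noteq> 0) \<and>
    (\<forall>(i, j) \<in> T. B i j = u i * A i j * v j)" for u v T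
  have finS: "finite S"
    by (rule finite_subset[of _ "{..<n} \<times> {..<n}"]) (auto simp: S_def)
  have "scaled (\<lambda>_. 1) (\<lambda>_. 1) {}" by (simp add: scaled_def)
  define \<T> where "\<T> = {T. T \<subseteq> S \<and> (\<exists>u v. scaled u v T)}"
  have "{} \<in> \<T>" using \<open>scaled _ _ {}\<close> unfolding \<T>_def by blast
  moreover have "finite \<T>" using finS unfolding \<T>_def by simp
  ultimately obtain T where "T \<in> \<T>" and max: "\<And>T'. T' \<in> \<T> \<Longrightarrow> T \<subseteq> T' \<Longrightarrow> T = T'"
    using finite_has_maximal[of \<T>] by blast
  then obtain u v where TS: "T \<subseteq> S" and uv: "scaled u v T" unfolding \<T>_def by blast
  have TA: "A i j \<noteq> 0" "i < n" "j < n" "B i j = u i * A i j * v j" if "(i, j) \<in> T" for i j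
    using that TS uv unfolding S_def scaled_def by auto
  have nz: "u i \<noteq> 0" "v i \<noteq> 0" if "i < n" for i using uv that unfolding scaled_def by auto
  have "S \<subseteq> T"
  proof (rule ccontr)
    assume "\<not> S \<subseteq> T"
    then obtain p q where pq: "(p, q) \<in> S" "(p, q) \<notin> T" by auto
    then have lt: "p < n" "q < n" and A: "A p q \<noteq> 0" unfolding S_def by auto
    have B: "B p q \<noteq> 0" using supp lt A by blast
    have noext: "\<not> scaled u' v' (insert (p, q) T)" for u' v'
      using max[of "insert (p, q) T"] pq TS unfolding \<T>_def by blast
    have T_sub: "T \<subseteq> {..<n} \<times> {..<n}" using TA by auto
    obtain R Q where RQ: "p \<in> R" "\<And>i j. (i, j) \<in> T \<Longrightarrow> i \<in> R \<longleftrightarrow> j \<in> Q"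
      and conn: "\<And>q. q \<in> Q \<Longrightarrow> \<exists>N x (y :: nat \<Rightarrow> 'a). path_matrix n T p q N x y"
      by (rule connected_component_path_matrix[OF T_sub lt(1), where 'a='a]) (rule that; assumption)
    show False
      \<comment> \<open>If \<open>(p, q)\<close> closes a cycle with \<open>T\<close>, the rank test forces the scaling there;
        otherwise rescaling one component extends it.\<close>
    proof (cases "q \<in> Q")
      case True
      then obtain N x y where pm: "path_matrix n T p q N x (y :: nat \<Rightarrow> 'a)" using conn by blast
      note N = path_matrixD(1)[OF pm] and yq = path_matrixD(4)[OF pm]
      have Npq: "N p q = 0" using N pq by blast
      define c where "c = - 1 / y q"
      define \<rho> where "\<rho> = B p q / (u p * A p q * v q)"
      note upd = rank_rank_one_update_eq_iff[OF lt pm]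
      define C where "C i j = (N i j + c * of_bool (i = p \<and> j = q)) / A i j" for i j
      have CA: "C i j * A i j = N i j + c * of_bool (i = p \<and> j = q)" for i j
        using TA(1) N A unfolding C_def by (cases "N i j = 0") auto
      have CB: "C i j * B i j = u i * (N i j + (c * \<rho>) * of_bool (i = p \<and> j = q)) * v j" for i j
      proof (cases "i = p \<and> j = q")
        case True
        then show ?thesis using Npq A nz lt unfolding C_def \<rho>_def by simp
      next
        case False
        then show ?thesis using TA(1,4)[of i j] N[of i j] unfolding C_def by (cases "N i j = 0") auto
      qed
      have "?rank (\<lambda>i j. N i j + c * of_bool (i = p \<and> j = q)) =
          ?rank (\<lambda>i j. u i * (N i j + (c * \<rho>) * of_bool (i = p \<and> j = q)) * v j)"
        using eq[of C] unfolding CA CB .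
      also have "\<dots> = ?rank (\<lambda>i j. N i j + (c * \<rho>) * of_bool (i = p \<and> j = q))"
        by (rule rank_diag_scale) (use nz in auto)
      finally have "c * y q \<noteq> - 1 \<longleftrightarrow> (c * \<rho>) * y q \<noteq> -1"
        using upd[of c] upd[of "c * \<rho>"] by simp
      then have "\<rho> = 1" using yq unfolding c_def by simp
      then have "B p q = u p * A p q * v q"
        using A nz lt unfolding \<rho>_def by (simp add: divide_eq_1_iff)
      then have "scaled u v (insert (p, q) T)" using uv unfolding scaled_def by auto
      then show False using noext by blast
    next
      case False
      define s where "s = B p q / (u p * A p q * v q)"
      have s: "s \<noteq> 0" using A B nz lt unfolding s_def by simp
      have "scaled (\<lambda>i. if i \<in> R then s * u i else u i) (\<lambda>j. if j \<in> Q then v j / s else v j)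
          (insert (p, q) T)"
        unfolding scaled_def
      proof (intro conjI allI impI ballI, goal_cases)
        case (3 ij)
        show ?case
        proof (cases "ij = (p, q)")
          case True
          then show ?thesis using RQ(1) False nz[OF lt(1)] nz[OF lt(2)] A by (simp add: s_def)
        next
          case False
          then obtain i j where ij: "ij = (i, j)" "(i, j) \<in> T" using 3 by (cases ij) auto
          then show ?thesis using RQ(2)[OF ij(2)] TA(4)[OF ij(2)] s by simp
        qed
      qed (use nz s in auto)
      then show False using noext by blast
    qed
  qed
  show thesis
  proof (rule that[of u v])
    show "B i j = u i * A i j * v j" if "i < n" "j < n" for i j
      using supp[OF that] TA(4)[of i j] \<open>S \<subseteq> T\<close> that unfolding S_def by (cases "A i j = 0") auto
  qed (use nz in auto)
qed

section \<open>Evaluation of generic matrices\<close>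

definition lsum :: "('m \<Rightarrow> 'a) \<Rightarrow> ('m \<Rightarrow>\<^sub>0 'a::field) \<Rightarrow> 'a" where
  "lsum h f = (\<Sum>m\<in>Poly_Mapping.keys f. Poly_Mapping.lookup f m * h m)"

lemma lsum_superset:
  assumes "finite S" "Poly_Mapping.keys f \<subseteq> S"
  shows "lsum h f = (\<Sum>m\<in>S. Poly_Mapping.lookup f m * h m)"
  unfolding lsum_def using assms
  by (intro sum.mono_neutral_left) (auto simp: in_keys_iff)

lemma lsum_add: "lsum h (f + g) = lsum h f + lsum h g"
proof -
  let ?S = "Poly_Mapping.keys f \<union> Poly_Mapping.keys g"
  have "lsum h (f + g) = (\<Sum>m\<in>?S. Poly_Mapping.lookup (f + g) m * h m)"
    by (rule lsum_superset) (simp_all add: keys_add)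
  also have "\<dots> = (\<Sum>m\<in>?S. Poly_Mapping.lookup f m * h m) + (\<Sum>m\<in>?S. Poly_Mapping.lookup g m * h m)"
    by (simp add: lookup_add distrib_right sum.distrib)
  also have "\<dots> = lsum h f + lsum h g"
    using lsum_superset[of ?S f h] lsum_superset[of ?S g h] by simp
  finally show ?thesis .
qed

lemma lsum_zero [simp]: "lsum h 0 = 0"
  by (simp add: lsum_def)

lemma lsum_sum: "lsum h (\<Sum>i\<in>I. f i) = (\<Sum>i\<in>I. lsum h (f i))"
  by (induction I rule: infinite_finite_induct) (simp_all add: lsum_add)

lemma lsum_single [simp]: "lsum h (Poly_Mapping.single m c) = c * h m"
  by (simp add: lsum_def)

lemma poly_mapping_eq_sum_single:
  "f = (\<Sum>m\<in>Poly_Mapping.keys f. Poly_Mapping.single m (Poly_Mapping.lookup f m))"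
proof (rule poly_mapping_eqI)
  fix k
  have "(\<Sum>m\<in>Poly_Mapping.keys f. Poly_Mapping.lookup (Poly_Mapping.single m (Poly_Mapping.lookup f m)) k) =
      (\<Sum>m\<in>Poly_Mapping.keys f. if m = k then Poly_Mapping.lookup f k else 0)"
    by (intro sum.cong) (auto simp: lookup_single when_def)
  then show "Poly_Mapping.lookup f k =
      Poly_Mapping.lookup (\<Sum>m\<in>Poly_Mapping.keys f. Poly_Mapping.single m (Poly_Mapping.lookup f m)) k"
    by (auto simp: lookup_sum in_keys_iff)
qed

definition monom_eval :: "('v \<Rightarrow> 'a::field) \<Rightarrow> ('v \<Rightarrow>\<^sub>0 nat) \<Rightarrow> 'a" where
  "monom_eval \<alpha> m = (\<Prod>v\<in>Poly_Mapping.keys m. \<alpha> v ^ Poly_Mapping.lookup m v)"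

lemma monom_eval_superset:
  assumes "finite S" "Poly_Mapping.keys m \<subseteq> S"
  shows "monom_eval \<alpha> m = (\<Prod>v\<in>S. \<alpha> v ^ Poly_Mapping.lookup m v)"
  unfolding monom_eval_def using assms
  by (intro prod.mono_neutral_left) (auto simp: in_keys_iff)

lemma monom_eval_add: "monom_eval \<alpha> (m + m') = monom_eval \<alpha> m * monom_eval \<alpha> m'"
proof -
  let ?S = "Poly_Mapping.keys m \<union> Poly_Mapping.keys m'"
  have "monom_eval \<alpha> (m + m') = (\<Prod>v\<in>?S. \<alpha> v ^ Poly_Mapping.lookup (m + m') v)"
    by (rule monom_eval_superset) (simp_all add: keys_add)
  also have "\<dots> = (\<Prod>v\<in>?S. \<alpha> v ^ Poly_Mapping.lookup m v) * (\<Prod>v\<in>?S. \<alpha> v ^ Poly_Mapping.lookup m' v)"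
    by (simp add: lookup_add power_add prod.distrib)
  also have "\<dots> = monom_eval \<alpha> m * monom_eval \<alpha> m'"
    using monom_eval_superset[of ?S m \<alpha>] monom_eval_superset[of ?S m' \<alpha>] by simp
  finally show ?thesis .
qed

lemma ceval_eq_lsum: "ceval \<alpha> p = lsum (monom_eval \<alpha>) p"
  by (simp add: ceval_def lsum_def monom_eval_def)

lemma ceval_sum: "ceval \<alpha> (\<Sum>i\<in>I. f i) = (\<Sum>i\<in>I. ceval \<alpha> (f i))"
  by (simp add: ceval_eq_lsum lsum_sum)

lemma ceval_mult: "ceval \<alpha> (p * q) = ceval \<alpha> p * ceval \<alpha> q"
proof -
  let ?s = "\<lambda>p m. Poly_Mapping.single m (Poly_Mapping.lookup p m)"
  have "p * q = (\<Sum>m\<in>Poly_Mapping.keys p. ?s p m) * (\<Sum>m\<in>Poly_Mapping.keys q. ?s q m)"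
    using poly_mapping_eq_sum_single[of p] poly_mapping_eq_sum_single[of q] by simp
  also have "\<dots> = (\<Sum>m\<in>Poly_Mapping.keys p. \<Sum>m'\<in>Poly_Mapping.keys q.
      Poly_Mapping.single (m + m') (Poly_Mapping.lookup p m * Poly_Mapping.lookup q m'))"
    by (simp add: sum_product mult_single)
  also have "ceval \<alpha> \<dots> = (\<Sum>m\<in>Poly_Mapping.keys p. \<Sum>m'\<in>Poly_Mapping.keys q.
      (Poly_Mapping.lookup p m * monom_eval \<alpha> m) * (Poly_Mapping.lookup q m' * monom_eval \<alpha> m'))"
    by (simp add: ceval_eq_lsum lsum_sum monom_eval_add mult_ac)
  also have "\<dots> = ceval \<alpha> p * ceval \<alpha> q"
    unfolding ceval_eq_lsum lsum_def by (simp add: sum_product)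
  finally show ?thesis .
qed

lemma ceval_cconst [simp]: "ceval \<alpha> (cconst c) = c"
  by (simp add: ceval_eq_lsum cconst_def monom_eval_def)

lemma ceval_cvar [simp]: "ceval \<alpha> (cvar v) = \<alpha> v"
  by (simp add: ceval_eq_lsum cvar_def monom_eval_def)

primrec word_val :: "nat \<Rightarrow> 'a::field mat \<times> 'a mat \<Rightarrow> letter list \<Rightarrow> 'a mat" where
  "word_val n A [] = 1\<^sub>m n"
| "word_val n A (k # w) = pick k A * word_val n A w"

context
  fixes n :: nat and A :: "'a::field mat \<times> 'a mat"
  assumes A: "fst A \<in> carrier_mat n n" "snd A \<in> carrier_mat n n"
begin

lemma pick_carrier [simp]: "pick k A \<in> carrier_mat n n"
  using A by (cases A; cases k) auto

lemma word_val_carrier [simp]: "word_val n A w \<in> carrier_mat n n"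
  by (induction w) (simp_all add: mult_carrier_mat[OF pick_carrier])

lemma word_val_append: "word_val n A (v @ w) = word_val n A v * word_val n A w"
proof (induction v)
  case (Cons k v)
  then show ?case
    using assoc_mult_mat[OF pick_carrier word_val_carrier word_val_carrier, of k v w] by simp
qed (simp add: left_mult_one_mat[OF word_val_carrier])

lemma word_val_replicate_L1: "word_val n A (replicate k L1) = fst A ^\<^sub>m k"
proof (induction k)
  case (Suc k)
  have "replicate (Suc k) L1 = replicate k L1 @ [L1]" by (simp only: replicate_append_same replicate_Suc)
  moreover have "word_val n A [L1] = fst A"
    using A by (cases A) (simp add: right_mult_one_mat)
  ultimately show ?case using Suc by (simp only: word_val_append pow_mat.simps)
qed (use A in simp)

lemma word_val_sandwich:
  "word_val n A (replicate k L1 @ L2 # replicate l L1) = fst A ^\<^sub>m k * snd A * fst A ^\<^sub>m l"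
proof -
  have "pick L2 A = snd A" by (cases A) simp
  then have "word_val n A (replicate k L1 @ L2 # replicate l L1) = fst A ^\<^sub>m k * (snd A * fst A ^\<^sub>m l)"
    by (simp add: word_val_append word_val_replicate_L1)
  then show ?thesis using A by (simp add: assoc_mult_mat[of _ n n _ n _ n])
qed

end

lemma generic_word_carrier [simp]: "generic_word n w \<in> carrier_mat n n"
  by (induction w) (simp_all add: generic_mat_def mult_carrier_mat[of _ n n])

lemma generic_word_in_generic_alg: "generic_word n w \<in> generic_alg n"
  by (induction w) (simp_all add: generic_alg.one generic_alg.mult generic_alg.gen)

lemma ceval_generic_word:
  assumes A: "fst A \<in> carrier_mat n n" "snd A \<in> carrier_mat n n" and "i < n" "j < n"
  shows "ceval (\<lambda>(i, j, k). pick k A $$ (i, j)) (generic_word n w $$ (i, j)) = word_val n A w $$ (i, j)"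
  using assms(3)
proof (induction w arbitrary: i)
  case Nil
  have "ceval \<alpha> 1 = (1::'a)" "ceval \<alpha> 0 = (0::'a)" for \<alpha> :: "nat \<times> nat \<times> letter \<Rightarrow> 'a"
    using ceval_cconst[of \<alpha> 1] ceval_cconst[of \<alpha> 0] unfolding cconst_def by simp_all
  then show ?case using Nil assms(4) by simp
next
  case (Cons k w)
  have gk: "(generic_mat n k :: 'a cpoly mat) \<in> carrier_mat n n" by (simp add: generic_mat_def)
  let ?ev = "ceval (\<lambda>(i, j, k). pick k A $$ (i, j))"
  have "generic_word n (k # w) $$ (i, j) =
      (\<Sum>l<n. (cvar (i, l, k) :: 'a cpoly) * generic_word n w $$ (l, j))"
    using Cons(2) assms(4) gk carrier_matD[OF generic_word_carrier[of n w, where 'a='a]]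
    by (simp add: scalar_prod_def generic_mat_def atLeast0LessThan)
  then have "?ev (generic_word n (k # w) $$ (i, j)) =
      (\<Sum>l<n. pick k A $$ (i, l) * ?ev (generic_word n w $$ (l, j)))"
    by (simp only: ceval_sum ceval_mult ceval_cvar case_prod_conv)
  also have "\<dots> = (\<Sum>l<n. pick k A $$ (i, l) * word_val n A w $$ (l, j))"
    by (intro sum.cong refl arg_cong2[where f="(*)"] Cons(1)) simp
  also have "\<dots> = word_val n A (k # w) $$ (i, j)"
    using Cons(2) assms(4) carrier_matD[OF pick_carrier[OF A, of k]] carrier_matD[OF word_val_carrier[OF A, of w]]
    by (simp add: scalar_prod_def atLeast0LessThan)
  finally show ?case .
qed

lemma subst_nc_generic:
  assumes A: "fst A \<in> carrier_mat n n" "snd A \<in> carrier_mat n n"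
  shows "subst (nc_generic n f) A = mat n n (\<lambda>(i, j). lsum (\<lambda>w. word_val n A w $$ (i, j)) f)"
proof (rule eq_matI)
  let ?ev = "ceval (\<lambda>(i, j, k). pick k A $$ (i, j))"
  fix i j
  assume "i < dim_row (mat n n (\<lambda>(i, j). lsum (\<lambda>w. word_val n A w $$ (i, j)) f))"
    "j < dim_col (mat n n (\<lambda>(i, j). lsum (\<lambda>w. word_val n A w $$ (i, j)) f))"
  then have ij: "i < n" "j < n" by simp_all
  then have "subst (nc_generic n f) A $$ (i, j) =
      ?ev (\<Sum>w\<in>Poly_Mapping.keys f. cconst (Poly_Mapping.lookup f w) * generic_word n w $$ (i, j))"
    by (simp add: subst_def nc_generic_def)
  also have "\<dots> = lsum (\<lambda>w. word_val n A w $$ (i, j)) f"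
    unfolding ceval_sum ceval_mult ceval_cconst ceval_generic_word[OF A ij] lsum_def ..
  finally show "subst (nc_generic n f) A $$ (i, j) =
      mat n n (\<lambda>(i, j). lsum (\<lambda>w. word_val n A w $$ (i, j)) f) $$ (i, j)"
    using ij by simp
qed (simp_all add: subst_def nc_generic_def)

lemma nc_generic_in_generic_alg: "nc_generic n f \<in> generic_alg n"
proof -
  have "mat n n (\<lambda>(i, j). \<Sum>w\<in>W. cconst (c w) * generic_word n w $$ (i, j)) \<in> generic_alg n"
    if "finite W" for W and c :: "letter list \<Rightarrow> 'a"
    using that
  proof induction
    case empty
    have "mat n n (\<lambda>(i, j). \<Sum>w\<in>{}. cconst (c w) * generic_word n w $$ (i, j)) = cconst 0 \<cdot>\<^sub>m 1\<^sub>m n"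
      by (intro eq_matI) (simp_all add: cconst_def)
    then show ?case using generic_alg.smult[OF generic_alg.one, of 0 n] by (simp only:)
  next
    case (insert w W)
    have "mat n n (\<lambda>(i, j). \<Sum>w\<in>insert w W. cconst (c w) * generic_word n w $$ (i, j)) =
        cconst (c w) \<cdot>\<^sub>m generic_word n w + mat n n (\<lambda>(i, j). \<Sum>w\<in>W. cconst (c w) * generic_word n w $$ (i, j))"
      using insert carrier_matD[OF generic_word_carrier[of n w, where 'a='a]] by (intro eq_matI) simp_all
    then show ?case
      using generic_alg.add[OF generic_alg.smult[OF generic_word_in_generic_alg, of "c w" n w] insert.IH]
      by (simp only:)
  qed
  then show ?thesis unfolding nc_generic_def by simp
qed

lemma generic_degree_nc_generic_le:
  assumes "\<And>w. w \<in> Poly_Mapping.keys f \<Longrightarrow> length w \<le> d"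
  shows "generic_degree n (nc_generic n f) \<le> d"
proof -
  have "generic_degree n (nc_generic n f) \<le> nc_degree f"
    unfolding generic_degree_def by (rule Least_le) blast
  also have "\<dots> \<le> d" unfolding nc_degree_def using assms by auto
  finally show ?thesis .
qed

lemma mat_mult_index:
  assumes "M \<in> carrier_mat n m" "N \<in> carrier_mat m k" "i < n" "j < k"
  shows "(M * N) $$ (i, j) = (\<Sum>a<m. M $$ (i, a) * N $$ (a, j))"
  using assms by (simp add: scalar_prod_def atLeast0LessThan)

lemma mat_mult3_index:
  assumes P: "(P :: 'a::field mat) \<in> carrier_mat n n" and X: "X \<in> carrier_mat n n"
    and Q: "Q \<in> carrier_mat n n" and ij: "i < n" "j < n"
  shows "(P * X * Q) $$ (i, j) = (\<Sum>b<n. \<Sum>a<n. P $$ (i, a) * X $$ (a, b) * Q $$ (b, j))"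
  unfolding mat_mult_index[OF mult_carrier_mat[OF P X] Q ij]
  by (intro sum.cong refl) (simp add: mat_mult_index[OF P X ij(1)] sum_distrib_right)

lemma word_val_conj:
  fixes P :: "'a::field mat"
  assumes X: "X \<in> carrier_mat n n" and Y: "Y \<in> carrier_mat n n"
    and P: "P \<in> carrier_mat n n" and Q: "Q \<in> carrier_mat n n"
    and PQ: "P * Q = 1\<^sub>m n" and QP: "Q * P = 1\<^sub>m n"
  shows "word_val n (P * X * Q, P * Y * Q) w = P * word_val n (X, Y) w * Q"
proof (induction w)
  case Nil
  then show ?case using P PQ by simp
next
  case (Cons k w)
  define Z where "Z = pick k (X, Y)"
  define W where "W = word_val n (X, Y) w"
  have Z: "Z \<in> carrier_mat n n" using X Y unfolding Z_def by (cases k) simp_all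
  have W: "W \<in> carrier_mat n n" using X Y unfolding W_def by simp
  have "pick k (P * X * Q, P * Y * Q) = P * Z * Q" unfolding Z_def by (cases k) simp_all
  then have "word_val n (P * X * Q, P * Y * Q) (k # w) = (P * Z * Q) * (P * W * Q)"
    using Cons unfolding W_def by simp
  also have "\<dots> = P * Z * (Q * P) * W * Q"
    using P Q Z W by (simp add: assoc_mult_mat[of _ n n _ n _ n])
  also have "\<dots> = P * (Z * W) * Q"
    unfolding QP using P Q Z W by (simp add: assoc_mult_mat[of _ n n _ n _ n])
  finally show ?case unfolding Z_def W_def by simp
qed

lemma subst_nc_generic_conj:
  fixes P :: "'a::field mat"
  assumes X: "X \<in> carrier_mat n n" and Y: "Y \<in> carrier_mat n n"
    and P: "P \<in> carrier_mat n n" and Q: "Q \<in> carrier_mat n n"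
    and PQ: "P * Q = 1\<^sub>m n" and QP: "Q * P = 1\<^sub>m n"
  shows "subst (nc_generic n f) (P * X * Q, P * Y * Q) = P * subst (nc_generic n f) (X, Y) * Q"
proof -
  have c: "fst (P * X * Q, P * Y * Q) \<in> carrier_mat n n" "snd (P * X * Q, P * Y * Q) \<in> carrier_mat n n"
    "fst (X, Y) \<in> carrier_mat n n" "snd (X, Y) \<in> carrier_mat n n"
    using X Y P Q by simp_all
  let ?W = "word_val n (X, Y)"
  let ?S = "mat n n (\<lambda>(i, j). lsum (\<lambda>w. ?W w $$ (i, j)) f)"
  have S: "?S \<in> carrier_mat n n" by simp
  show ?thesis
    unfolding subst_nc_generic[OF c(1,2)] subst_nc_generic[OF c(3,4)]
  proof (rule eq_matI)
    fix i j assume "i < dim_row (P * ?S * Q)" "j < dim_col (P * ?S * Q)"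
    then have ij: "i < n" "j < n" using P Q by simp_all
    have "(P * ?S * Q) $$ (i, j) = (\<Sum>b<n. \<Sum>a<n. P $$ (i, a) * lsum (\<lambda>w. ?W w $$ (a, b)) f * Q $$ (b, j))"
      unfolding mat_mult3_index[OF P S Q ij] by simp
    also have "\<dots> = (\<Sum>b<n. \<Sum>a<n. \<Sum>w\<in>Poly_Mapping.keys f.
        Poly_Mapping.lookup f w * (P $$ (i, a) * ?W w $$ (a, b) * Q $$ (b, j)))"
      unfolding lsum_def by (simp add: sum_distrib_left sum_distrib_right mult_ac)
    also have "\<dots> = (\<Sum>b<n. \<Sum>w\<in>Poly_Mapping.keys f. \<Sum>a<n.
        Poly_Mapping.lookup f w * (P $$ (i, a) * ?W w $$ (a, b) * Q $$ (b, j)))"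
      by (intro sum.cong refl sum.swap)
    also have "\<dots> = (\<Sum>w\<in>Poly_Mapping.keys f. \<Sum>b<n. \<Sum>a<n.
        Poly_Mapping.lookup f w * (P $$ (i, a) * ?W w $$ (a, b) * Q $$ (b, j)))"
      by (rule sum.swap)
    also have "\<dots> = lsum (\<lambda>w. (P * ?W w * Q) $$ (i, j)) f"
      unfolding lsum_def mat_mult3_index[OF P word_val_carrier[OF c(3,4)] Q ij]
      by (simp add: sum_distrib_left)
    finally show "mat n n (\<lambda>(i, j). lsum (\<lambda>w. word_val n (P * X * Q, P * Y * Q) w $$ (i, j)) f) $$ (i, j) =
        (P * ?S * Q) $$ (i, j)"
      using ij by (simp add: word_val_conj[OF assms])
  qed (use P Q in simp_all)
qed

definition sandwich_poly :: "nat \<Rightarrow> (nat \<Rightarrow> nat \<Rightarrow> 'a) \<Rightarrow> (nat \<Rightarrow> 'a) \<Rightarrow> 'a::field ncpoly" where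
  "sandwich_poly n \<alpha> \<beta> =
     (\<Sum>k<n. \<Sum>l<n. Poly_Mapping.single (replicate k L1 @ L2 # replicate l L1) (\<alpha> k l)) +
     (\<Sum>k<n. Poly_Mapping.single (replicate k L1) (\<beta> k))"

lemma length_keys_sandwich_poly:
  assumes w: "w \<in> Poly_Mapping.keys (sandwich_poly n \<alpha> \<beta>)"
  shows "length w \<le> 2 * n - 1"
proof (rule ccontr)
  assume "\<not> length w \<le> 2 * n - 1"
  then have "replicate k L1 @ L2 # replicate l L1 \<noteq> w" "replicate k L1 \<noteq> w" if "k < n" "l < n" for k l
    using that by auto
  then have "Poly_Mapping.lookup (sandwich_poly n \<alpha> \<beta>) w = 0"
    unfolding sandwich_poly_def lookup_add lookup_sum lookup_single by (simp add: when_def)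
  then show False using w by (simp add: in_keys_iff)
qed

lemma subst_sandwich_poly_diagm:
  assumes M: "M \<in> carrier_mat n n"
  shows "subst (nc_generic n (sandwich_poly n \<alpha> \<beta>)) (diagm n u, M) = mat n n (\<lambda>(i, j).
    (\<Sum>k<n. \<Sum>l<n. \<alpha> k l * u i ^ k * u j ^ l) * M $$ (i, j) + of_bool (i = j) * (\<Sum>k<n. \<beta> k * u i ^ k))"
proof -
  have c: "fst (diagm n u, M) \<in> carrier_mat n n" "snd (diagm n u, M) \<in> carrier_mat n n"
    using M by simp_all
  have 1: "word_val n (diagm n u, M) (replicate k L1 @ L2 # replicate l L1) =
      mat n n (\<lambda>(i, j). u i ^ k * M $$ (i, j) * u j ^ l)" for k l
    unfolding word_val_sandwich[OF c] fst_conv snd_conv diagm_pow diagm_mult_left[OF M]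
    by (subst diagm_mult_right) auto
  have 2: "word_val n (diagm n u, M) (replicate k L1) = diagm n (\<lambda>i. u i ^ k)" for k
    unfolding word_val_replicate_L1[OF c] fst_conv diagm_pow ..
  show ?thesis
    unfolding subst_nc_generic[OF c] sandwich_poly_def lsum_add lsum_sum lsum_single 1 2
    by (intro cong_mat refl) (auto simp: diagm_def sum_distrib_left sum_distrib_right mult_ac)
qed

section \<open>Diagonalization and interpolation\<close>

lemma interpolation_exists:
  fixes lam c :: "nat \<Rightarrow> 'a::field"
  assumes "inj_on lam {..<n}"
  shows "\<exists>\<beta>. \<forall>i<n. (\<Sum>k<n. \<beta> k * lam i ^ k) = c i"
proof -
  have "\<exists>p. (\<forall>i<n. poly p (lam i) = c i) \<and> (\<forall>k\<ge>n. coeff p k = 0)"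
    using assms
  proof (induction n)
    case 0
    then show ?case by (intro exI[of _ 0]) simp
  next
    case (Suc n)
    then obtain p where p: "\<And>i. i < n \<Longrightarrow> poly p (lam i) = c i" "\<And>k. k \<ge> n \<Longrightarrow> coeff p k = 0"
      by (auto simp: lessThan_Suc)
    define q where "q = (\<Prod>i<n. [:- lam i, 1:])"
    have q0: "poly q (lam i) = 0" if "i < n" for i
      using that unfolding q_def poly_prod by (intro prod_zero) auto
    have qn: "poly q (lam n) \<noteq> 0"
      unfolding q_def poly_prod using inj_onD[OF Suc.prems, of n] by fastforce
    have "degree q \<le> (\<Sum>i<n. degree [:- lam i, 1:])"
      unfolding q_def by (rule degree_prod_sum_le[unfolded o_def]) simp
    then have "degree q \<le> n" by simp
    then have qc: "coeff q k = 0" if "k \<ge> Suc n" for k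
      using that by (intro coeff_eq_0) simp
    define r where "r = p + Polynomial.smult ((c n - poly p (lam n)) / poly q (lam n)) q"
    have "poly r (lam i) = c i" if "i < Suc n" for i
    proof (cases "i = n")
      case True
      then show ?thesis using qn unfolding r_def by simp
    next
      case False
      then show ?thesis using that p(1) q0 unfolding r_def by simp
    qed
    moreover have "coeff r k = 0" if "k \<ge> Suc n" for k
      using that p(2) qc unfolding r_def by simp
    ultimately show ?case by blast
  qed
  then obtain p where p: "\<And>i. i < n \<Longrightarrow> poly p (lam i) = c i" "\<And>k. k \<ge> n \<Longrightarrow> coeff p k = 0"
    by blast
  have "(\<Sum>k<n. coeff p k * x ^ k) = poly p x" for x
  proof -
    have "poly p x = (\<Sum>k\<le>degree p. coeff p k * x ^ k)" by (rule poly_altdef)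
    also have "\<dots> = (\<Sum>k\<in>{..degree p} \<union> {..<n}. coeff p k * x ^ k)"
      by (rule sum.mono_neutral_left) (auto simp: coeff_eq_0)
    also have "\<dots> = (\<Sum>k<n. coeff p k * x ^ k)"
      by (rule sum.mono_neutral_right) (auto simp: p(2))
    finally show ?thesis ..
  qed
  then show ?thesis using p(1) by (intro exI[of _ "coeff p"]) auto
qed

lemma interpolation_exists2:
  fixes lam :: "nat \<Rightarrow> 'a::field"
  assumes "inj_on lam {..<n}"
  shows "\<exists>\<alpha>. \<forall>i<n. \<forall>j<n. (\<Sum>k<n. \<Sum>l<n. \<alpha> k l * lam i ^ k * lam j ^ l) = C i j"
proof -
  have "\<exists>\<gamma>. \<forall>j. \<forall>i<n. (\<Sum>k<n. \<gamma> j k * lam i ^ k) = C i j"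
    using interpolation_exists[OF assms, of "\<lambda>i. C i j" for j] by (intro choice allI)
  then obtain \<gamma> where \<gamma>: "\<And>i j. i < n \<Longrightarrow> (\<Sum>k<n. \<gamma> j k * lam i ^ k) = C i j" by blast
  have "\<exists>\<alpha>. \<forall>k. \<forall>j<n. (\<Sum>l<n. \<alpha> k l * lam j ^ l) = \<gamma> j k"
    using interpolation_exists[OF assms, of "\<lambda>j. \<gamma> j k" for k] by (intro choice allI)
  then obtain \<alpha> where \<alpha>: "\<And>k j. j < n \<Longrightarrow> (\<Sum>l<n. \<alpha> k l * lam j ^ l) = \<gamma> j k" by blast
  have "(\<Sum>k<n. \<Sum>l<n. \<alpha> k l * lam i ^ k * lam j ^ l) = C i j" if "i < n" "j < n" for i j
  proof -
    have "(\<Sum>k<n. \<Sum>l<n. \<alpha> k l * lam i ^ k * lam j ^ l) = (\<Sum>k<n. (\<Sum>l<n. \<alpha> k l * lam j ^ l) * lam i ^ k)"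
      by (simp add: sum_distrib_left mult_ac)
    then show ?thesis using that by (simp add: \<alpha> \<gamma>)
  qed
  then show ?thesis by blast
qed

lemma similar_diagm_if_distinct_eigenvalues:
  fixes A :: "'a::field mat"
  assumes A: "A \<in> carrier_mat n n" and ev: "\<And>i. i < n \<Longrightarrow> eigenvalue A (lam i)"
    and inj: "inj_on lam {..<n}"
  obtains P Q where "similar_mat_wit A (diagm n lam) P Q"
proof -
  have "\<exists>v. \<forall>i<n. eigenvector A (v i) (lam i)"
    using ev unfolding eigenvalue_def by metis
  then obtain v where v: "\<And>i. i < n \<Longrightarrow> eigenvector A (v i) (lam i)" by blast
  have vc: "v i \<in> carrier_vec n" "v i \<noteq> 0\<^sub>v n" "A *\<^sub>v v i = lam i \<cdot>\<^sub>v v i" if "i < n" for i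
    using v[OF that] A unfolding eigenvector_def by auto
  define P where "P = mat n n (\<lambda>(i, j). v j $ i)"
  have P: "P \<in> carrier_mat n n" unfolding P_def by simp
  have AP: "A * P = P * diagm n lam"
  proof (rule eq_matI)
    fix i j assume "i < dim_row (P * diagm n lam)" "j < dim_col (P * diagm n lam)"
    then have ij: "i < n" "j < n" using P by (simp_all add: diagm_def)
    have "col P j = v j" using ij vc(1)[OF ij(2)] unfolding P_def by (intro eq_vecI) auto
    then have "(A * P) $$ (i, j) = (A *\<^sub>v v j) $ i"
      using ij A P by simp
    then show "(A * P) $$ (i, j) = (P * diagm n lam) $$ (i, j)"
      unfolding vc(3)[OF ij(2)] diagm_mult_right[OF P] using ij vc(1)[OF ij(2)] by (simp add: P_def)
  qed (use A P in \<open>simp_all add: diagm_def\<close>)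
  have "det P \<noteq> 0"
  proof
    assume "det P = 0"
    then obtain x where x: "x \<in> carrier_vec n" "x \<noteq> 0\<^sub>v n" "P *\<^sub>v x = 0\<^sub>v n"
      using det_0_iff_vec_prod_zero_field[OF P] by blast
    define w where "w k = vec n (\<lambda>j. lam j ^ k * x $ j)" for k
    have wc: "w k \<in> carrier_vec n" for k unfolding w_def by simp
    have A0: "A *\<^sub>v 0\<^sub>v n = 0\<^sub>v n" using A by (intro eq_vecI) auto
    have w0: "P *\<^sub>v w k = 0\<^sub>v n" for k
    proof (induction k)
      case 0
      have "w 0 = x" using x(1) unfolding w_def by (intro eq_vecI) auto
      then show ?case using x by simp
    next
      case (Suc k)
      have "w (Suc k) = diagm n lam *\<^sub>v w k"
        by (intro eq_vecI)
          (auto simp: w_def diagm_def scalar_prod_def if_distrib if_distribR cong: if_cong)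
      then have "P *\<^sub>v w (Suc k) = (P * diagm n lam) *\<^sub>v w k"
        using assoc_mult_mat_vec[OF P diagm_carrier wc] by simp
      also have "\<dots> = A *\<^sub>v (P *\<^sub>v w k)"
        unfolding AP[symmetric] by (rule assoc_mult_mat_vec[OF A P wc])
      finally show ?case using Suc A0 by simp
    qed
    have w0i: "(\<Sum>j<n. v j $ i * (lam j ^ k * x $ j)) = 0" if "i < n" for i k
    proof -
      have "(P *\<^sub>v w k) $ i = (\<Sum>j<n. v j $ i * (lam j ^ k * x $ j))"
        using that unfolding w_def P_def by (simp add: scalar_prod_def atLeast0LessThan)
      then show ?thesis using w0[of k] that by simp
    qed
    have "x $ m = 0" if m: "m < n" for m
    proof -
      obtain \<beta> where \<beta>: "\<And>j. j < n \<Longrightarrow> (\<Sum>k<n. \<beta> k * lam j ^ k) = of_bool (j = m)"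
        using interpolation_exists[OF inj, of "\<lambda>j. of_bool (j = m)"] by blast
      obtain i where i: "i < n" "v m $ i \<noteq> 0"
        using vc(1,2)[OF m] by (metis carrier_vecD eq_vecI index_zero_vec)
      have "0 = (\<Sum>k<n. \<beta> k * (\<Sum>j<n. v j $ i * (lam j ^ k * x $ j)))"
        using w0i[OF i(1)] by simp
      also have "\<dots> = (\<Sum>k<n. \<Sum>j<n. v j $ i * x $ j * (\<beta> k * lam j ^ k))"
        by (simp add: sum_distrib_left mult_ac)
      also have "\<dots> = (\<Sum>j<n. v j $ i * x $ j * (\<Sum>k<n. \<beta> k * lam j ^ k))"
        by (subst sum.swap) (simp add: sum_distrib_left)
      also have "\<dots> = (\<Sum>j<n. if j = m then v j $ i * x $ j else 0)"
        by (intro sum.cong) (auto simp: \<beta>)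
      also have "\<dots> = v m $ i * x $ m" using m by simp
      finally show ?thesis using i(2) by simp
    qed
    then have "x = 0\<^sub>v n" using x(1) by (intro eq_vecI) auto
    then show False using x(2) by simp
  qed
  then have "P \<in> Units (ring_mat TYPE('a) n ())" by (rule det_non_zero_imp_unit[OF P])
  then obtain Q where Q: "Q \<in> carrier_mat n n" "Q * P = 1\<^sub>m n" "P * Q = 1\<^sub>m n"
    unfolding Units_def ring_mat_simps by auto
  have "A = A * (P * Q)" using A Q by simp
  also have "\<dots> = A * P * Q" using A P Q(1) by (simp add: assoc_mult_mat[of _ n n _ n _ n])
  finally have "A = P * diagm n lam * Q" unfolding AP .
  then show thesis using that similar_mat_witI[OF Q(3,2) _ A diagm_carrier P Q(1)] by blast
qed

lemma GL_orbit_iff: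
  fixes A :: "'a::field mat \<times> 'a mat"
  assumes A: "fst A \<in> carrier_mat n n" "snd A \<in> carrier_mat n n"
  shows "X \<in> GL_orbit n A \<longleftrightarrow>
    (\<exists>g h. similar_mat_wit (fst X) (fst A) g h \<and> similar_mat_wit (snd X) (snd A) g h)"
proof
  assume "X \<in> GL_orbit n A"
  then obtain g h where gh: "X = (g * fst A * h, g * snd A * h)" "g \<in> carrier_mat n n"
    "h \<in> carrier_mat n n" "g * h = 1\<^sub>m n" "h * g = 1\<^sub>m n"
    unfolding GL_orbit_def GL_def inverts_mat_def by auto
  then have "similar_mat_wit (fst X) (fst A) g h" "similar_mat_wit (snd X) (snd A) g h"
    using A by (auto intro!: similar_mat_witI[of _ _ n])
  then show "\<exists>g h. similar_mat_wit (fst X) (fst A) g h \<and> similar_mat_wit (snd X) (snd A) g h"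
    by blast
next
  assume "\<exists>g h. similar_mat_wit (fst X) (fst A) g h \<and> similar_mat_wit (snd X) (snd A) g h"
  then obtain g h where gh: "similar_mat_wit (fst X) (fst A) g h" "similar_mat_wit (snd X) (snd A) g h"
    by blast
  note 1 = similar_mat_witD2[OF A(1) similar_mat_wit_sym[OF gh(1)]]
  have eq: "fst X = g * fst A * h" "snd X = g * snd A * h"
    using similar_mat_witD(3)[OF refl gh(1)] similar_mat_witD(3)[OF refl gh(2)] by auto
  have inv: "inverts_mat g h" "inverts_mat h g" using 1 unfolding inverts_mat_def by auto
  then have "g \<in> GL n" using 1 unfolding GL_def invertible_mat_def by auto
  moreover have "X = (g * fst A * h, g * snd A * h)" using eq by (metis prod.collapse)
  ultimately show "X \<in> GL_orbit n A"
    unfolding GL_orbit_def using inv 1 by blast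
qed

lemma GL_orbit_eqI:
  fixes A B :: "'a::field mat \<times> 'a mat"
  assumes A: "fst A \<in> carrier_mat n n" "snd A \<in> carrier_mat n n"
    and B: "fst B \<in> carrier_mat n n" "snd B \<in> carrier_mat n n"
    and gh: "similar_mat_wit (fst B) (fst A) g h" "similar_mat_wit (snd B) (snd A) g h"
  shows "GL_orbit n A = GL_orbit n B"
proof (rule Set.set_eqI)
  fix X
  show "X \<in> GL_orbit n A \<longleftrightarrow> X \<in> GL_orbit n B"
    unfolding GL_orbit_iff[OF A] GL_orbit_iff[OF B]
    using gh similar_mat_wit_sym[OF gh(1)] similar_mat_wit_sym[OF gh(2)]
    by (blast intro: similar_mat_wit_trans)
qed

section \<open>Separation of orbits\<close>

lemma rank_conj:
  fixes M :: "'a::field mat"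
  assumes "M \<in> carrier_mat n n" "P \<in> carrier_mat n n" "Q \<in> carrier_mat n n" "P * Q = 1\<^sub>m n" "Q * P = 1\<^sub>m n"
  shows "vec_space.rank n (P * M * Q) = vec_space.rank n M"
proof -
  interpret vec_space "TYPE('a)" n .
  show ?thesis
    using rank_mult_right_inv[OF mult_carrier_mat[OF assms(2,1)] assms(3,2,5)]
      rank_mult_left_inv[OF assms(1,2,3,5)] by simp
qed

lemma similar_diagm_if_scaled:
  assumes A: "A \<in> carrier_mat n n" and B: "B \<in> carrier_mat n n"
    and uv: "\<And>i. i < n \<Longrightarrow> u i * v i = 1"
    and eq: "\<And>i j. i < n \<Longrightarrow> j < n \<Longrightarrow> B $$ (i, j) = u i * A $$ (i, j) * v j"
  shows "similar_mat_wit B A (diagm n u) (diagm n v)"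
proof (rule similar_mat_witI[OF _ _ _ B A])
  show "diagm n u * diagm n v = 1\<^sub>m n" "diagm n v * diagm n u = 1\<^sub>m n"
    using uv by (simp_all add: diagm_mult_diagm diagm_one mult.commute)
  show "B = diagm n u * A * diagm n v"
    unfolding diagm_mult_left[OF A] using B eq by (subst diagm_mult_right) (auto intro!: eq_matI)
qed simp_all

lemma scaled_if_rank_nc_generic_eq:
  fixes A B :: "'a::field mat"
  assumes A: "A \<in> carrier_mat n n" and B: "B \<in> carrier_mat n n" and inj: "inj_on lam {..<n}"
    and rank_eq: "\<And>\<alpha> \<beta>. vec_space.rank n (subst (nc_generic n (sandwich_poly n \<alpha> \<beta>)) (diagm n lam, A)) =
      vec_space.rank n (subst (nc_generic n (sandwich_poly n \<alpha> \<beta>)) (diagm n lam, B))"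
  obtains u v where "\<And>i. i < n \<Longrightarrow> u i * v i = 1"
    "\<And>i j. i < n \<Longrightarrow> j < n \<Longrightarrow> B $$ (i, j) = u i * A $$ (i, j) * v j"
proof -
  define ev where "ev C c M = mat n n (\<lambda>(i, j). C i j * M $$ (i, j) + of_bool (i = j) * c i)"
    for C c and M :: "'a mat"
  have ev_rank: "vec_space.rank n (ev C c A) = vec_space.rank n (ev C c B)" for C c
  proof -
    obtain \<alpha> where \<alpha>: "\<And>i j. i < n \<Longrightarrow> j < n \<Longrightarrow> (\<Sum>k<n. \<Sum>l<n. \<alpha> k l * lam i ^ k * lam j ^ l) = C i j"
      using interpolation_exists2[OF inj, of C] by blast
    obtain \<beta> where \<beta>: "\<And>i. i < n \<Longrightarrow> (\<Sum>k<n. \<beta> k * lam i ^ k) = c i"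
      using interpolation_exists[OF inj, of c] by blast
    have "subst (nc_generic n (sandwich_poly n \<alpha> \<beta>)) (diagm n lam, M) = ev C c M"
      if "M \<in> carrier_mat n n" for M
      unfolding subst_sandwich_poly_diagm[OF that] ev_def by (rule cong_mat) (simp_all add: \<alpha> \<beta>)
    then show ?thesis using rank_eq[of \<alpha> \<beta>] A B by simp
  qed
  have diag: "B $$ (a, a) = A $$ (a, a)" if a: "a < n" for a
  proof -
    let ?C = "\<lambda>i j. of_bool (i = a \<and> j = a)" and ?c = "\<lambda>i. - of_bool (i = a) * A $$ (a, a)"
    have "ev ?C ?c A = 0\<^sub>m n n" unfolding ev_def by (intro eq_matI) auto
    then have "vec_space.rank n (ev ?C ?c B) = 0"
      using ev_rank[of ?C ?c] rank_eq_0_iff[of "0\<^sub>m n n :: 'a mat" n n] by simp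
    then have "ev ?C ?c B = 0\<^sub>m n n"
      using rank_eq_0_iff[of "ev ?C ?c B" n n] by (simp add: ev_def)
    then have "ev ?C ?c B $$ (a, a) = 0" using a by simp
    then show ?thesis using a unfolding ev_def by simp
  qed
  \<comment> \<open>The identity matrix lies in the algebra, so the diagonal may be replaced by ones; this
    forces \<open>u i * v i = 1\<close>, and \<open>B\<close> is a conjugate of \<open>A\<close> by a diagonal matrix.\<close>
  define unit_diag where "unit_diag M i j = (if i = j then 1 else M $$ (i, j))" for M :: "'a mat" and i j
  have hadamard: "vec_space.rank n (mat n n (\<lambda>(i, j). C i j * unit_diag A i j)) =
      vec_space.rank n (mat n n (\<lambda>(i, j). C i j * unit_diag B i j))" for C
  proof -
    have "mat n n (\<lambda>(i, j). C i j * unit_diag M i j) =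
        ev (\<lambda>i j. if i = j then 0 else C i j) (\<lambda>i. C i i) M" for M
      unfolding ev_def by (rule cong_mat) (auto simp: unit_diag_def)
    then show ?thesis using ev_rank by simp
  qed
  obtain u v where uv: "\<And>i j. i < n \<Longrightarrow> j < n \<Longrightarrow> unit_diag B i j = u i * unit_diag A i j * v j"
    by (rule rank_hadamard_eq_imp_scaled[OF hadamard]) (rule that; assumption)
  have uv1: "u i * v i = 1" if "i < n" for i
    using uv[OF that that] by (simp add: unit_diag_def)
  show thesis
  proof (rule that[of u v])
    show "B $$ (i, j) = u i * A $$ (i, j) * v j" if "i < n" "j < n" for i j
    proof (cases "i = j")
      case True
      then show ?thesis using diag[OF that(1)] uv1[OF that(1)] by (simp add: mult.assoc mult.left_commute)
    next
      case False
      then show ?thesis using uv[OF that] by (simp add: unit_diag_def)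
    qed
  qed (rule uv1)
qed

lemma eigenvalue_iff_rank_less:
  assumes A: "fst A \<in> carrier_mat n n" "snd A \<in> carrier_mat n n"
  shows "eigenvalue (fst A) c \<longleftrightarrow> vec_space.rank n
    (subst (nc_generic n (Poly_Mapping.single [L1] 1 + Poly_Mapping.single [] (- c))) A) \<noteq> n"
proof -
  have "word_val n A [L1] = fst A" using A by (cases A) (simp add: right_mult_one_mat)
  then have eq: "subst (nc_generic n (Poly_Mapping.single [L1] 1 + Poly_Mapping.single [] (- c))) A =
      char_matrix (fst A) c"
    unfolding subst_nc_generic[OF A] lsum_add lsum_single char_matrix_def
    using A by (intro eq_matI) auto
  have "char_matrix (fst A) c \<in> carrier_mat n n" using A(1) by simp
  then show ?thesis
    unfolding eq eigenvalue_det[OF A(1)] using vec_space.det_rank_iff[of "char_matrix (fst A) c" n] by blast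
qed

theorem theorem4p4:
  fixes n :: nat and A B :: "'a::field mat \<times> 'a mat"
  assumes "n \<ge> 2"
    and "\<exists>S::'a set. finite S \<and> card S = n"
    and "A \<in> D n" and "B \<in> D n"
    and "\<And>F. F \<in> generic_alg n \<Longrightarrow> generic_degree n F \<le> (n + 1) * (2 * n - 1) \<Longrightarrow>
           vec_space.rank n (subst F A) = vec_space.rank n (subst F B)"
  shows "GL_orbit n A = GL_orbit n B"
proof -
  have A: "fst A \<in> carrier_mat n n" "snd A \<in> carrier_mat n n" "card {c. eigenvalue (fst A) c} = n"
    using assms(3) unfolding D_def by auto
  have B: "fst B \<in> carrier_mat n n" "snd B \<in> carrier_mat n n"
    using assms(4) unfolding D_def by auto
  have rank_eq: "vec_space.rank n (subst (nc_generic n f) A) = vec_space.rank n (subst (nc_generic n f) B)"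
    if "\<And>w. w \<in> Poly_Mapping.keys f \<Longrightarrow> length w \<le> 2 * n - 1" for f
  proof (rule assms(5)[OF nc_generic_in_generic_alg])
    show "generic_degree n (nc_generic n f) \<le> (n + 1) * (2 * n - 1)"
      using generic_degree_nc_generic_le[of f "2 * n - 1" n] that by (simp add: trans_le_add1)
  qed
  have eig: "eigenvalue (fst A) c \<longleftrightarrow> eigenvalue (fst B) c" for c
  proof -
    have "Poly_Mapping.keys (Poly_Mapping.single [L1] 1 + Poly_Mapping.single [] (- c)) \<subseteq> {[L1], []}"
      by (rule order.trans[OF keys_add]) auto
    then have "length w \<le> 2 * n - 1"
      if "w \<in> Poly_Mapping.keys (Poly_Mapping.single [L1] 1 + Poly_Mapping.single [] (- c))" for w
      using that assms(1) by auto
    then show ?thesis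
      unfolding eigenvalue_iff_rank_less[OF A(1,2)] eigenvalue_iff_rank_less[OF B] by (simp only: rank_eq)
  qed
  have "finite {c. eigenvalue (fst A) c}" using A(3) assms(1) by (intro card_ge_0_finite) simp
  then obtain lam where lam: "bij_betw lam {..<n} {c. eigenvalue (fst A) c}"
    using ex_bij_betw_nat_finite[of "{c. eigenvalue (fst A) c}"] A(3) by (auto simp: atLeast0LessThan)
  then have inj: "inj_on lam {..<n}" and ev: "\<And>i. i < n \<Longrightarrow> eigenvalue (fst A) (lam i)"
    by (auto simp: bij_betw_def)
  obtain P Q where PQ: "similar_mat_wit (fst A) (diagm n lam) P Q"
    using similar_diagm_if_distinct_eigenvalues[OF A(1) ev inj] by blast
  obtain P' Q' where PQ': "similar_mat_wit (fst B) (diagm n lam) P' Q'"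
    using similar_diagm_if_distinct_eigenvalues[OF B(1) _ inj] ev eig by blast
  have reduce: "\<exists>M. M \<in> carrier_mat n n \<and> similar_mat_wit (snd X) M P Q \<and>
      (\<forall>f. vec_space.rank n (subst (nc_generic n f) X) = vec_space.rank n (subst (nc_generic n f) (diagm n lam, M)))"
    if X: "fst X \<in> carrier_mat n n" "snd X \<in> carrier_mat n n"
      and PQ: "similar_mat_wit (fst X) (diagm n lam) P Q" for X P Q
  proof (intro exI conjI allI)
    note PQ = similar_mat_witD2[OF X(1) PQ]
    define M where "M = Q * snd X * P"
    show M: "M \<in> carrier_mat n n" using PQ X unfolding M_def by simp
    have wit: "similar_mat_wit M (snd X) Q P"
      by (rule similar_mat_witI[OF PQ(2,1) M_def M X(2) PQ(7,6)])
    then show "similar_mat_wit (snd X) M P Q" by (rule similar_mat_wit_sym)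
    then have "X = (P * diagm n lam * Q, P * M * Q)"
      using PQ(3) similar_mat_witD(3)[OF refl] by (metis prod.collapse)
    then show "vec_space.rank n (subst (nc_generic n f) X) =
        vec_space.rank n (subst (nc_generic n f) (diagm n lam, M))" for f
      using subst_nc_generic_conj[OF diagm_carrier M PQ(6,7,1,2), of f]
        rank_conj[OF _ PQ(6,7,1,2), of "subst (nc_generic n f) (diagm n lam, M)"]
      by (simp add: subst_def nc_generic_def)
  qed
  obtain M where M: "M \<in> carrier_mat n n" "similar_mat_wit (snd A) M P Q"
    "\<And>f. vec_space.rank n (subst (nc_generic n f) A) = vec_space.rank n (subst (nc_generic n f) (diagm n lam, M))"
    using reduce[OF A(1,2) PQ] by blast
  obtain N where N: "N \<in> carrier_mat n n" "similar_mat_wit (snd B) N P' Q'"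
    "\<And>f. vec_space.rank n (subst (nc_generic n f) B) = vec_space.rank n (subst (nc_generic n f) (diagm n lam, N))"
    using reduce[OF B PQ'] by blast
  have sandwich: "vec_space.rank n (subst (nc_generic n (sandwich_poly n \<alpha> \<beta>)) (diagm n lam, M)) =
      vec_space.rank n (subst (nc_generic n (sandwich_poly n \<alpha> \<beta>)) (diagm n lam, N))" for \<alpha> \<beta>
    unfolding M(3)[symmetric] N(3)[symmetric] by (rule rank_eq) (rule length_keys_sandwich_poly)
  obtain u v where uv: "\<And>i. i < n \<Longrightarrow> u i * v i = 1"
    "\<And>i j. i < n \<Longrightarrow> j < n \<Longrightarrow> N $$ (i, j) = u i * M $$ (i, j) * v j"
    by (rule scaled_if_rank_nc_generic_eq[OF M(1) N(1) inj sandwich]) (rule that; assumption)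
  have "similar_mat_wit N M (diagm n u) (diagm n v)"
    by (rule similar_diagm_if_scaled[OF M(1) N(1) uv])
  moreover have "similar_mat_wit (diagm n lam) (diagm n lam) (diagm n u) (diagm n v)"
  proof (rule similar_diagm_if_scaled[OF diagm_carrier diagm_carrier uv(1)])
    show "diagm n lam $$ (i, j) = u i * diagm n lam $$ (i, j) * v j" if "i < n" "j < n" for i j
      using that uv(1)[OF that(1)] by (cases "i = j") (simp_all add: diagm_def mult.left_commute)
  qed
  ultimately have "similar_mat_wit (fst B) (fst A) (P' * diagm n u * Q) (P * (diagm n v * Q'))"
    "similar_mat_wit (snd B) (snd A) (P' * diagm n u * Q) (P * (diagm n v * Q'))"
    using PQ PQ' M(2) N(2) by (blast intro: similar_mat_wit_trans similar_mat_wit_sym)+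
  then show ?thesis by (rule GL_orbit_eqI[OF A(1,2) B])
qed

end
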